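(* Let $d\ge1$, $p\ge2$, let $\mathbb X\subset\mathbb R^d$ be open, let $b:\mathbb X\to\mathbb R^d$ and $\sigma:\mathbb X\to\mathbb R^{d\times d}$ be functions, put $a(x)=\sigma(x)\sigma(x)^T$, and let $\mathcal L$ be the differential operator $$\mathcal L\phi(x)=\tfrac12\,a(x):\nabla^2\phi(x)+b(x)\cdot\nabla\phi(x),\qquad\phi\in C^2(\mathbb X).$$ For $1\le k\le p$ let $\psi_k=(\psi_{k,1},\dots,\psi_{k,n_k})^T:\mathbb X\to\mathbb R^{n_k}$ be a vector of twice continuously differentiable functions. For $x\in\mathbb X$ let $\mathcal L\boldsymbol\Psi(x)\in\mathbb R^{n_1\times\cdots\times n_p}$ be the tensor with entries $$\mathcal L\boldsymbol\Psi(x)_{u_1,\dots,u_p}=\mathcal L\big(\psi_{1,u_1}\cdot\ldots\cdot\psi_{p,u_p}\big)(x).$$ Write $\delta_{k,i}:=\nabla\psi_k(x)\cdot\sigma_{:,i}(x)\in\mathbb R^{n_k}$. Then $\mathcal L\boldsymbol\Psi(x)$ has the tensor train representation $\mathcal L\boldsymbol\Psi(x)=[\![\mathcal L\boldsymbol\Psi^{(1)}(x)]\!]\otimes\cdots\otimes[\![\mathcal L\boldsymbol\Psi^{(p)}(x)]\!]$ with ranks $r_1,\dots,r_{p-1}$ all equal to $d+2$ and cores $$[\![\mathcal L\boldsymbol\Psi^{(1)}(x)]\!]=\begin{bmatrix}\psi_1(x)&\mathcal L\psi_1(x)&\delta_{1,1}&\cdots&\delta_{1,d}\end{bmatrix},$$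 $$[\![\mathcal L\boldsymbol\Psi^{(k)}(x)]\!]=\begin{bmatrix}\psi_k(x)&\mathcal L\psi_k(x)&\delta_{k,1}&\cdots&\delta_{k,d}\\0&\psi_k(x)&0&\cdots&0\\0&\delta_{k,1}&\psi_k(x)&&0\\\vdots&\vdots&&\ddots&\\0&\delta_{k,d}&0&&\psi_k(x)\end{bmatrix}\quad(2\le k\le p-1),$$ $$[\![\mathcal L\boldsymbol\Psi^{(p)}(x)]\!]=\begin{bmatrix}\mathcal L\psi_p(x)&\psi_p(x)&\delta_{p,1}&\cdots&\delta_{p,d}\end{bmatrix}^T.$$
   Context: $A:B=\mathrm{tr}(A^TB)$ is the Frobenius inner product, $\nabla\phi$ the gradient and $\nabla^2\phi$ the Hessian of a scalar function. For vector-valued $\psi_k$, $\mathcal L\psi_k(x)\in\mathbb R^{n_k}$ is obtained by applying $\mathcal L$ to every component, $\nabla\psi_k(x)\in\mathbb R^{n_k\times d}$ is the Jacobian, $\sigma_{:,i}(x)\in\mathbb R^d$ is the $i$-th column of $\sigma(x)$, and $\nabla\psi_k(x)\cdot\sigma_{:,i}(x)$ is the matrix-vector product. The tensor product of vectors $v^{(k)}\in\mathbb R^{n_k}$ is $(v^{(1)}\otimes\cdots\otimes v^{(p)})_{u_1,\dots,u_p}=\prod_{k=1}^p v^{(k)}_{u_k}$. Tensor train (TT) format: given cores $\mathbf T^{(k)}\in\mathbb R^{r_{k-1}\times n_k\times r_k}$, $k=1,\dots,p$, with $r_0=r_p=1$, the associated tensor is $$\mathbf T=\sum_{s_0=1}^{r_0}\cdots\sum_{s_p=1}^{r_p}\mathbf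 T^{(1)}_{s_0,:,s_1}\otimes\cdots\otimes\mathbf T^{(p)}_{s_{p-1},:,s_p}.$$ The $r_k$ are the TT ranks (sizes of the cores of the representation). Rank-core notation: $[\![\mathbf T^{(k)}]\!]$ is the $r_{k-1}\times r_k$ matrix whose $(s,t)$ entry is the vector $\mathbf T^{(k)}_{s,:,t}\in\mathbb R^{n_k}$; $[\![\mathbf T^{(1)}]\!]\otimes\cdots\otimes[\![\mathbf T^{(p)}]\!]$ is the formal matrix product in which entries are multiplied by $\otimes$, and it equals the sum above. An entry $0$ is the zero vector. *)

theory Defs
  imports "HOL-Analysis.Analysis"
begin

definition partial :: "'d::finite \<Rightarrow> (real^'d \<Rightarrow> real) \<Rightarrow> real^'d \<Rightarrow> real" where
  "partial i \<phi> x = frechet_derivative \<phi> (at x) (axis i 1)"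

text \<open>
  Continuous partials of a differentiable function on an open set are the same as a continuous
  derivative, so \<open>C2_on X\<close> is \<open>C\<^sup>2(X)\<close> for open \<open>X\<close>.
\<close>

definition C1_on :: "(real^'d::finite) set \<Rightarrow> (real^'d \<Rightarrow> real) \<Rightarrow> bool" where
  "C1_on X \<phi> \<longleftrightarrow> (\<forall>x\<in>X. \<phi> differentiable (at x)) \<and> (\<forall>i. continuous_on X (partial i \<phi>))"

definition C2_on :: "(real^'d::finite) set \<Rightarrow> (real^'d \<Rightarrow> real) \<Rightarrow> bool" where
  "C2_on X \<phi> \<longleftrightarrow> C1_on X \<phi> \<and> (\<forall>i. C1_on X (partial i \<phi>))"

definition grad :: "(real^'d::finite \<Rightarrow> real) \<Rightarrow> real^'d \<Rightarrow> real^'d" where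
  "grad \<phi> x = (\<chi> i. partial i \<phi> x)"

definition hessian :: "(real^'d::finite \<Rightarrow> real) \<Rightarrow> real^'d \<Rightarrow> real^'d^'d" where
  "hessian \<phi> x = (\<chi> i j. partial i (partial j \<phi>) x)"

definition frobenius :: "real^'d::finite^'d \<Rightarrow> real^'d^'d \<Rightarrow> real" where
  "frobenius A B = trace (transpose A ** B)"

definition diffusion :: "(real^'d::finite \<Rightarrow> real^'d^'d) \<Rightarrow> real^'d \<Rightarrow> real^'d^'d" where
  "diffusion \<sigma> x = \<sigma> x ** transpose (\<sigma> x)"

definition generator ::
  "(real^'d::finite \<Rightarrow> real^'d) \<Rightarrow> (real^'d \<Rightarrow> real^'d^'d) \<Rightarrow> (real^'d \<Rightarrow> real) \<Rightarrow> real^'d \<Rightarrow> real" where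
  "generator b \<sigma> \<phi> x = 1/2 * frobenius (diffusion \<sigma> x) (hessian \<phi> x) + b x \<bullet> grad \<phi> x"

text \<open>
  Since the mode sizes vary with the position in the train, a vector in \<open>\<real>\<^sup>m\<close> is a function
  \<open>nat \<Rightarrow> real\<close> of which only the values at \<open>1, \<dots>, m\<close> matter. Likewise a tensor of order \<open>p\<close>
  and size \<open>n\<^sub>1 \<times> \<dots> \<times> n\<^sub>p\<close> is a function of which only the values on \<open>multi_indices p n\<close> matter,
  and a core \<open>T k\<close> of size \<open>r\<^sub>k\<^sub>-\<^sub>1 \<times> n\<^sub>k \<times> r\<^sub>k\<close> is given by its rank-core matrix: \<open>T k s t\<close>
  is the vector entry \<open>(s, t)\<close>, for \<open>1 \<le> s \<le> r (k - 1)\<close> and \<open>1 \<le> t \<le> r k\<close>.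
\<close>

type_synonym rvec = "nat \<Rightarrow> real"
type_synonym tensor = "(nat \<Rightarrow> nat) \<Rightarrow> real"
type_synonym core = "nat \<Rightarrow> nat \<Rightarrow> rvec"

definition multi_indices :: "nat \<Rightarrow> (nat \<Rightarrow> nat) \<Rightarrow> (nat \<Rightarrow> nat) set" where
  "multi_indices p n = (\<Pi>\<^sub>E k\<in>{1..p}. {1..n k})"

definition tensor_product :: "nat \<Rightarrow> (nat \<Rightarrow> rvec) \<Rightarrow> tensor" where
  "tensor_product p v u = (\<Prod>k=1..p. v k (u k))"

text \<open>
  The tensor represented by the cores \<open>T 1, \<dots>, T p\<close>, that is, the formal matrix product of their
  rank-core matrices written out as a sum over the rank indices \<open>s 0, \<dots>, s p\<close>.
\<close>

definition tt_tensor :: "nat \<Rightarrow> (nat \<Rightarrow> nat) \<Rightarrow> (nat \<Rightarrow> core) \<Rightarrow> tensor" where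
  "tt_tensor p r T u =
     (\<Sum>s\<in>(\<Pi>\<^sub>E k\<in>{0..p}. {1..r k}). tensor_product p (\<lambda>k. T k (s (k - 1)) (s k)) u)"

definition tt_representation ::
  "nat \<Rightarrow> (nat \<Rightarrow> nat) \<Rightarrow> (nat \<Rightarrow> nat) \<Rightarrow> (nat \<Rightarrow> core) \<Rightarrow> tensor \<Rightarrow> bool" where
  "tt_representation p n r T A \<longleftrightarrow>
     r 0 = 1 \<and> r p = 1 \<and> (\<forall>u\<in>multi_indices p n. A u = tt_tensor p r T u)"

definition generator_tensor ::
  "nat \<Rightarrow> (real^'d::finite \<Rightarrow> real^'d) \<Rightarrow> (real^'d \<Rightarrow> real^'d^'d) \<Rightarrow>
   (nat \<Rightarrow> nat \<Rightarrow> real^'d \<Rightarrow> real) \<Rightarrow> real^'d \<Rightarrow> tensor" where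
  "generator_tensor p b \<sigma> \<psi> x u = generator b \<sigma> (\<lambda>y. \<Prod>k=1..p. \<psi> k (u k) y) x"

definition jacobian_row :: "(nat \<Rightarrow> real^'d::finite \<Rightarrow> real) \<Rightarrow> real^'d \<Rightarrow> nat \<Rightarrow> real^'d" where
  "jacobian_row f x u = grad (f u) x"

definition delta ::
  "(real^'d::finite \<Rightarrow> real^'d^'d) \<Rightarrow> (nat \<Rightarrow> real^'d \<Rightarrow> real) \<Rightarrow> real^'d \<Rightarrow> 'd \<Rightarrow> rvec" where
  "delta \<sigma> f x i u = jacobian_row f x u \<bullet> column i (\<sigma> x)"

text \<open>
  The block patterns of the first, middle and last core, filled with vectors \<open>v\<close> (for \<open>\<psi>\<^sub>k(x)\<close>),
  \<open>w\<close> (for \<open>\<L>\<psi>\<^sub>k(x)\<close>) and \<open>g 1, \<dots>, g d\<close> (for \<open>\<delta>\<^sub>k\<^sub>,\<^sub>1, \<dots>, \<delta>\<^sub>k\<^sub>,\<^sub>d\<close>).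
\<close>

definition first_core :: "rvec \<Rightarrow> rvec \<Rightarrow> (nat \<Rightarrow> rvec) \<Rightarrow> core" where
  "first_core v w g s t = (if t = 1 then v else if t = 2 then w else g (t - 2))"

definition middle_core :: "rvec \<Rightarrow> rvec \<Rightarrow> (nat \<Rightarrow> rvec) \<Rightarrow> core" where
  "middle_core v w g s t =
     (if s = 1 then (if t = 1 then v else if t = 2 then w else g (t - 2))
      else if s = 2 then (if t = 2 then v else (\<lambda>_. 0))
      else (if t = 2 then g (s - 2) else if t = s then v else (\<lambda>_. 0)))"

definition last_core :: "rvec \<Rightarrow> rvec \<Rightarrow> (nat \<Rightarrow> rvec) \<Rightarrow> core" where
  "last_core v w g s t = (if s = 1 then w else if s = 2 then v else g (s - 2))"

text \<open>
  The cores need the coordinates of \<open>\<real>\<^sup>d\<close> in some order, but an index type carries none;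
  \<open>e\<close> is a numbering of them by \<open>1, \<dots>, d\<close>.
\<close>

definition generator_core ::
  "(nat \<Rightarrow> 'd::finite) \<Rightarrow> nat \<Rightarrow> (real^'d \<Rightarrow> real^'d) \<Rightarrow> (real^'d \<Rightarrow> real^'d^'d) \<Rightarrow>
   (nat \<Rightarrow> nat \<Rightarrow> real^'d \<Rightarrow> real) \<Rightarrow> real^'d \<Rightarrow> nat \<Rightarrow> core" where
  "generator_core e p b \<sigma> \<psi> x k =
     (if k = 1 then first_core else if k = p then last_core else middle_core)
       (\<lambda>u. \<psi> k u x) (\<lambda>u. generator b \<sigma> (\<psi> k u) x) (\<lambda>i. delta \<sigma> (\<psi> k) x (e i))"

end

theory Submission imports Defs begin

text \<open>
  By the product rule \<open>\<L>(fg) = f \<L>g + g \<L>f + \<Sum>\<^sub>i (\<nabla>f \<cdot> \<sigma>\<^sub>:\<^sub>,\<^sub>i) (\<nabla>g \<cdot> \<sigma>\<^sub>:\<^sub>,\<^sub>i)\<close>, multiplying the row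
  \<open>(P, \<L>P, \<nabla>P \<cdot> \<sigma>\<^sub>:\<^sub>,\<^sub>1, \<dots>, \<nabla>P \<cdot> \<sigma>\<^sub>:\<^sub>,\<^sub>d)\<close> by the middle core of a function \<open>g\<close> yields the same row with \<open>P g\<close>
  in place of \<open>P\<close>. Hence the first \<open>m\<close> cores multiply to the row of \<open>P = \<psi>\<^sub>1 \<cdots> \<psi>\<^sub>m\<close>, and the last core,
  which is the second column of a middle core, selects the \<open>\<L>\<close>-entry of the full product.
\<close>

section \<open>Partial derivatives and closure of C1 and C2 functions under products\<close>

lemma has_derivative_imp_partial:
  assumes "(f has_derivative f') (at x)"
  shows "partial i f x = f' (axis i 1)"
  using frechet_derivative_at[OF assms] by (simp add: partial_def)

lemma partial_const [simp]: "partial i (\<lambda>_. c) = (\<lambda>_. 0)"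
  by (rule ext, rule has_derivative_imp_partial[OF has_derivative_const])

lemma partial_add:
  assumes "f differentiable (at x)" "g differentiable (at x)"
  shows "partial i (\<lambda>y. f y + g y) x = partial i f x + partial i g x"
  using has_derivative_imp_partial[OF has_derivative_add[OF assms[unfolded frechet_derivative_works]]]
  by (simp add: partial_def)

lemma partial_mult:
  assumes "f differentiable (at x)" "g differentiable (at x)"
  shows "partial i (\<lambda>y. f y * g y) x = f x * partial i g x + partial i f x * g x"
  using has_derivative_imp_partial[OF has_derivative_mult[OF assms[unfolded frechet_derivative_works]]]
  by (simp add: partial_def)

text \<open>Derivatives at a point of an open set depend only on nearby values. This lets
  product-rule formulas, which hold on \<open>X\<close>, be differentiated a second time.\<close>

lemma partial_cong_open:
  assumes "open X" "x \<in> X" "\<And>y. y \<in> X \<Longrightarrow> f y = g y"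
  shows "partial i f x = partial i g x"
proof -
  \<comment> \<open>Both derivatives are chosen from the same predicate on \<open>D\<close>, so the
    choices agree.\<close>
  have "(f has_derivative D) (at x) = (g has_derivative D) (at x)" for D
    using assms has_derivative_transform_within_open by metis
  then show ?thesis by (simp add: partial_def frechet_derivative_def)
qed

lemma C1_on_imp_differentiable: "C1_on X f \<Longrightarrow> x \<in> X \<Longrightarrow> f differentiable (at x)"
  by (simp add: C1_on_def)

lemma C1_on_imp_continuous_on: "C1_on X f \<Longrightarrow> continuous_on X f"
  by (meson C1_on_imp_differentiable continuous_at_imp_continuous_on differentiable_imp_continuous_within)

lemma C1_on_const: "C1_on X (\<lambda>_. c)"
  by (simp add: C1_on_def)

lemma C1_on_cong_open:
  assumes "open X" "C1_on X f" "\<And>y. y \<in> X \<Longrightarrow> f y = g y"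
  shows "C1_on X g"
proof -
  have "g differentiable (at x)" if "x \<in> X" for x
    using assms that unfolding C1_on_def differentiable_def
    by (meson has_derivative_transform_within_open)
  moreover have "continuous_on X (partial i g)" for i
    using assms partial_cong_open[of X _ f g i] unfolding C1_on_def
    by (metis (no_types, lifting) continuous_on_cong)
  ultimately show ?thesis by (simp add: C1_on_def)
qed

lemma C1_on_add:
  assumes "C1_on X f" "C1_on X g"
  shows "C1_on X (\<lambda>y. f y + g y)"
proof -
  have "continuous_on X (partial i (\<lambda>y. f y + g y))" for i
  proof (rule continuous_on_eq)
    show "continuous_on X (\<lambda>y. partial i f y + partial i g y)"
      using assms by (intro continuous_intros) (auto simp: C1_on_def)
  qed (use assms in \<open>simp add: partial_add C1_on_def\<close>)
  then show ?thesis using assms by (simp add: C1_on_def)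
qed

lemma C1_on_mult:
  assumes "C1_on X f" "C1_on X g"
  shows "C1_on X (\<lambda>y. f y * g y)"
proof -
  have "continuous_on X (partial i (\<lambda>y. f y * g y))" for i
  proof (rule continuous_on_eq)
    show "continuous_on X (\<lambda>y. f y * partial i g y + partial i f y * g y)"
      using assms C1_on_imp_continuous_on[of X]
      by (intro continuous_intros) (auto simp: C1_on_def)
  qed (use assms in \<open>simp add: partial_mult C1_on_def\<close>)
  then show ?thesis using assms by (simp add: C1_on_def)
qed

lemma C2_on_const: "C2_on X (\<lambda>_. c)"
  by (simp add: C2_on_def C1_on_const)

lemma C2_on_mult:
  assumes "open X" "C2_on X f" "C2_on X g"
  shows "C2_on X (\<lambda>y. f y * g y)"
proof -
  have "C1_on X (partial i (\<lambda>y. f y * g y))" for i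
  proof (rule C1_on_cong_open[OF \<open>open X\<close>])
    show "C1_on X (\<lambda>y. f y * partial i g y + partial i f y * g y)"
      using assms by (intro C1_on_add C1_on_mult) (auto simp: C2_on_def)
  qed (use assms in \<open>simp add: partial_mult C2_on_def C1_on_def\<close>)
  then show ?thesis using assms by (simp add: C2_on_def C1_on_mult)
qed

lemma C2_on_prod:
  assumes "open X" "\<And>k. k \<in> K \<Longrightarrow> C2_on X (f k)"
  shows "C2_on X (\<lambda>y. \<Prod>k\<in>K. f k y)"
  using assms(2)
  by (induction K rule: infinite_finite_induct) (simp_all add: C2_on_const C2_on_mult[OF assms(1)])

section \<open>Product rule for the generator\<close>

lemma grad_mult:
  assumes "f differentiable (at x)" "g differentiable (at x)"
  shows "grad (\<lambda>y. f y * g y) x = f x *\<^sub>R grad g x + g x *\<^sub>R grad f x"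
  by (simp add: grad_def vec_eq_iff partial_mult[OF assms] mult.commute)

text \<open>The mixed terms are kept as two separate outer products so that the diffusion matrix can
  be contracted with each.\<close>

lemma hessian_mult:
  assumes "open X" "x \<in> X" "C2_on X f" "C2_on X g"
  shows "hessian (\<lambda>y. f y * g y) x =
    f x *\<^sub>R hessian g x + g x *\<^sub>R hessian f x +
    ((\<chi> i j. grad f x $ i * grad g x $ j) + (\<chi> i j. grad g x $ i * grad f x $ j))"
proof -
  note diff = C1_on_imp_differentiable[OF _ assms(2)]
  have f: "f differentiable (at x)" "partial j f differentiable (at x)" for j
    using assms(3) by (auto intro!: diff simp: C2_on_def)
  have g: "g differentiable (at x)" "partial j g differentiable (at x)" for j
    using assms(4) by (auto intro!: diff simp: C2_on_def)
  have "partial i (partial j (\<lambda>y. f y * g y)) x =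
      partial i (\<lambda>y. f y * partial j g y + partial j f y * g y) x" for i j
    using assms by (intro partial_cong_open[OF assms(1,2)]) (simp add: partial_mult C2_on_def C1_on_def)
  then show ?thesis
    by (simp add: hessian_def grad_def vec_eq_iff partial_add partial_mult f g algebra_simps)
qed

lemma frobenius_eq_sum: "frobenius A B = (\<Sum>i\<in>UNIV. \<Sum>j\<in>UNIV. A $ i $ j * B $ i $ j)"
  unfolding frobenius_def trace_def matrix_matrix_mult_def transpose_def
  by simp (rule sum.swap)

lemma frobenius_add_right: "frobenius A (B + C) = frobenius A B + frobenius A C"
  by (simp add: frobenius_eq_sum distrib_left sum.distrib)

lemma frobenius_scaleR_right: "frobenius A (c *\<^sub>R B) = c * frobenius A B"
  by (simp add: frobenius_eq_sum sum_distrib_left mult.left_commute)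

text \<open>Since the diffusion matrix is \<open>\<sigma> \<sigma>^T\<close>, the contraction is the
  inner product of \<open>\<sigma>^T v\<close> and \<open>\<sigma>^T w\<close>, taken column by
  column.\<close>

lemma frobenius_diffusion_outer:
  "frobenius (diffusion \<sigma> x) (\<chi> i j. v $ i * w $ j) =
    (\<Sum>k\<in>UNIV. (v \<bullet> column k (\<sigma> x)) * (w \<bullet> column k (\<sigma> x)))"
proof -
  have "frobenius (diffusion \<sigma> x) (\<chi> i j. v $ i * w $ j) =
      (\<Sum>i\<in>UNIV. \<Sum>j\<in>UNIV. \<Sum>k\<in>UNIV. (v $ i * \<sigma> x $ i $ k) * (w $ j * \<sigma> x $ j $ k))"
    by (simp add: frobenius_eq_sum diffusion_def matrix_matrix_mult_def transpose_def
        sum_distrib_left sum_distrib_right mult_ac)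
  also have "\<dots> = (\<Sum>i\<in>UNIV. \<Sum>k\<in>UNIV. \<Sum>j\<in>UNIV. (v $ i * \<sigma> x $ i $ k) * (w $ j * \<sigma> x $ j $ k))"
    by (intro sum.cong refl sum.swap)
  also have "\<dots> = (\<Sum>k\<in>UNIV. \<Sum>i\<in>UNIV. \<Sum>j\<in>UNIV. (v $ i * \<sigma> x $ i $ k) * (w $ j * \<sigma> x $ j $ k))"
    by (rule sum.swap)
  also have "\<dots> = (\<Sum>k\<in>UNIV. (v \<bullet> column k (\<sigma> x)) * (w \<bullet> column k (\<sigma> x)))"
    by (simp add: inner_vec_def column_def sum_product)
  finally show ?thesis .
qed

text \<open>The factor 1/2 cancels against the two equal mixed Hessian terms; the first-order drift
  contributes no mixed term.\<close>

lemma generator_mult: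
  assumes "open X" "x \<in> X" "C2_on X f" "C2_on X g"
  shows "generator b \<sigma> (\<lambda>y. f y * g y) x =
    f x * generator b \<sigma> g x + generator b \<sigma> f x * g x +
    (\<Sum>i\<in>UNIV. (grad f x \<bullet> column i (\<sigma> x)) * (grad g x \<bullet> column i (\<sigma> x)))"
proof -
  have "grad (\<lambda>y. f y * g y) x = f x *\<^sub>R grad g x + g x *\<^sub>R grad f x"
    using assms by (intro grad_mult) (auto simp: C2_on_def C1_on_def)
  moreover have "frobenius (diffusion \<sigma> x) (hessian (\<lambda>y. f y * g y) x) =
      f x * frobenius (diffusion \<sigma> x) (hessian g x) + g x * frobenius (diffusion \<sigma> x) (hessian f x) +
      2 * (\<Sum>i\<in>UNIV. (grad f x \<bullet> column i (\<sigma> x)) * (grad g x \<bullet> column i (\<sigma> x)))"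
    unfolding hessian_mult[OF assms] frobenius_add_right frobenius_scaleR_right frobenius_diffusion_outer
    by (simp add: mult.commute)
  ultimately show ?thesis
    by (simp add: generator_def inner_add_right algebra_simps)
qed

section \<open>Sums over rank indices as chains of matrix products\<close>

text \<open>\<open>v m\<close> is the row vector obtained by multiplying the first \<open>m\<close> matrices.\<close>

lemma sum_PiE_matrix_chain:
  fixes v :: "nat \<Rightarrow> nat \<Rightarrow> real"
  assumes "\<And>t. t \<in> {1..r 0} \<Longrightarrow> v 0 t = 1"
    and "\<And>m t. m < p \<Longrightarrow> t \<in> {1..r (Suc m)} \<Longrightarrow>
      v (Suc m) t = (\<Sum>s=1..r m. v m s * M (Suc m) s t)"
    and "m \<le> p"
  shows "(\<Sum>s\<in>(\<Pi>\<^sub>E k\<in>{0..m}. {1..r k}). (\<Prod>k=1..m. M k (s (k - 1)) (s k)) * f (s m)) =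
    (\<Sum>t=1..r m. v m t * f t)"
  using assms(3)
\<comment> \<open>The weight \<open>f\<close> stays arbitrary because the induction step absorbs a
  column of the next matrix into it.\<close>
proof (induction m arbitrary: f)
  case 0
  have "(\<Sum>s\<in>(\<Pi>\<^sub>E k\<in>{0::nat..0}. {1..r k}). f (s 0)) = (\<Sum>t=1..r 0. f t)"
    by (rule sum.reindex_bij_witness[where i = "\<lambda>t. (\<lambda>k\<in>{0}. t)" and j = "\<lambda>s. s 0"])
      (auto simp: PiE_iff extensional_def fun_eq_iff)
  then show ?case by (simp add: assms(1))
next
  case (Suc m)
  let ?Q = "\<Pi>\<^sub>E k\<in>{0..m}. {1..r k}"
  have "(\<Sum>s\<in>(\<Pi>\<^sub>E k\<in>{0..Suc m}. {1..r k}).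
        (\<Prod>k=1..Suc m. M k (s (k - 1)) (s k)) * f (s (Suc m))) =
      (\<Sum>(t, s)\<in>{1..r (Suc m)} \<times> ?Q.
        (\<Prod>k=1..Suc m. M k ((s(Suc m := t)) (k - 1)) ((s(Suc m := t)) k)) * f t)"
    \<comment> \<open>An index tuple on \<open>{0..Suc m}\<close> is one on \<open>{0..m}\<close>
      updated at \<open>Suc m\<close>, so the last index \<open>t\<close> can be summed
      separately.\<close>
    unfolding atLeast0_atMost_Suc PiE_insert_eq
    by (subst sum.reindex[OF inj_combinator]) (simp_all add: case_prod_unfold)
  also have "\<dots> = (\<Sum>(t, s)\<in>{1..r (Suc m)} \<times> ?Q.
      (\<Prod>k=1..m. M k (s (k - 1)) (s k)) * (M (Suc m) (s m) t * f t))"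
  proof (intro sum.cong refl, clarify)
    fix t s
    \<comment> \<open>Factors up to \<open>m\<close> read only indices up to \<open>m\<close>, which
      the update leaves alone.\<close>
    have "(\<Prod>k=1..m. M k ((s(Suc m := t)) (k - 1)) ((s(Suc m := t)) k)) =
        (\<Prod>k=1..m. M k (s (k - 1)) (s k))"
      by (intro prod.cong) auto
    then show "(\<Prod>k=1..Suc m. M k ((s(Suc m := t)) (k - 1)) ((s(Suc m := t)) k)) * f t =
        (\<Prod>k=1..m. M k (s (k - 1)) (s k)) * (M (Suc m) (s m) t * f t)"
      by (simp add: prod.atLeast1_atMost_eq mult.assoc del: fun_upd_apply) simp
  qed
  also have "\<dots> = (\<Sum>t=1..r (Suc m). \<Sum>s\<in>?Q.
      (\<Prod>k=1..m. M k (s (k - 1)) (s k)) * (M (Suc m) (s m) t * f t))"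
    by (simp add: sum.cartesian_product)
  also have "\<dots> = (\<Sum>t=1..r (Suc m). \<Sum>s=1..r m. v m s * (M (Suc m) s t * f t))"
    using Suc.prems by (intro sum.cong refl Suc.IH) simp
  also have "\<dots> = (\<Sum>t=1..r (Suc m). v (Suc m) t * f t)"
    using Suc.prems by (intro sum.cong refl) (simp add: assms(2) sum_distrib_right mult.assoc)
  finally show ?case .
qed

text \<open>Follows the block layout of the cores: two distinguished indices, then \<open>d\<close>
  indices shifted by 2.\<close>

lemma sum_split_first_two:
  fixes F :: "nat \<Rightarrow> real"
  shows "(\<Sum>s=1..d + 2. F s) = F 1 + F 2 + (\<Sum>i=1..d. F (i + 2))"
  by (induction d) (simp_all add: numeral_2_eq_2)

section \<open>Partial products and the generator cores\<close>

theorem corollary3p8: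
  fixes X :: "(real^'d::finite) set"
    and b :: "real^'d \<Rightarrow> real^'d"
    and \<sigma> :: "real^'d \<Rightarrow> real^'d^'d"
    and e :: "nat \<Rightarrow> 'd"
    and p :: nat
    and n :: "nat \<Rightarrow> nat"
    and \<psi> :: "nat \<Rightarrow> nat \<Rightarrow> real^'d \<Rightarrow> real"
    and x :: "real^'d"
  assumes "p \<ge> 2"
    and "open X"
    and "bij_betw e {1..CARD('d)} (UNIV :: 'd set)"
    and "\<And>k u. k \<in> {1..p} \<Longrightarrow> u \<in> {1..n k} \<Longrightarrow> C2_on X (\<psi> k u)"
    and "x \<in> X"
  shows "tt_representation p n (\<lambda>k. if k = 0 \<or> k = p then 1 else CARD('d) + 2)
           (generator_core e p b \<sigma> \<psi> x) (generator_tensor p b \<sigma> \<psi> x)"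
proof -
  define d where "d = CARD('d)"
  define r where "r = (\<lambda>k. if k = 0 \<or> k = p then 1 else d + 2)"
  have "generator_tensor p b \<sigma> \<psi> x u = tt_tensor p r (generator_core e p b \<sigma> \<psi> x) u"
    if u: "u \<in> multi_indices p n" for u
  proof -
    \<comment> \<open>Once the multi-index is fixed, the cores become real matrices
      \<open>M k\<close> and tensor products become ordinary ones.\<close>
    define f where "f = (\<lambda>k. \<psi> k (u k))"
    define P where "P = (\<lambda>m y. \<Prod>k=1..m. f k y)"
    define D where "D = (\<lambda>g i. grad g x \<bullet> column (e i) (\<sigma> x))"
    define M where "M = (\<lambda>k s t. generator_core e p b \<sigma> \<psi> x k s t (u k))"
    \<comment> \<open>The value 1 at \<open>m = 0\<close> starts the chain. For
      \<open>0 < m < p\<close> this is the full row of \<open>P m\<close>; at \<open>m = p\<close> a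
      single column is left, carrying the generator.\<close>
    define v where "v = (\<lambda>m t. if m = 0 then 1 else
      if m = p \<or> t = 2 then generator b \<sigma> (P m) x else if t = 1 then P m x else D (P m) (t - 2))"
    have C2f: "C2_on X (f k)" if "k \<in> {1..p}" for k
      unfolding f_def using u that by (intro assms(4)) (auto simp: multi_indices_def dest: PiE_mem)
    have C2P: "C2_on X (P m)" if "m \<le> p" for m
      unfolding P_def using that by (intro C2_on_prod assms(2) C2f) auto
    have P_Suc: "P (Suc m) = (\<lambda>y. P m y * f (Suc m) y)" for m
      by (simp add: P_def)
    have P_1: "P (Suc 0) = f (Suc 0)"
      by (simp add: P_def)
    have L_Suc: "generator b \<sigma> (P (Suc m)) x =
        P m x * generator b \<sigma> (f (Suc m)) x + generator b \<sigma> (P m) x * f (Suc m) x +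
        (\<Sum>i=1..d. D (P m) i * D (f (Suc m)) i)" if "m < p" for m
      using that sum.reindex_bij_betw[OF assms(3),
          of "\<lambda>i. (grad (P m) x \<bullet> column i (\<sigma> x)) * (grad (f (Suc m)) x \<bullet> column i (\<sigma> x))"]
      by (simp add: P_Suc generator_mult[OF assms(2,5) C2P C2f] D_def d_def)
    have D_Suc: "D (P (Suc m)) i = P m x * D (f (Suc m)) i + D (P m) i * f (Suc m) x" if "m < p" for m i
    proof -
      have "P m differentiable (at x)" "f (Suc m) differentiable (at x)"
        using C2P[of m] C2f[of "Suc m"] that assms(5) by (auto simp: C2_on_def C1_on_def)
      then show ?thesis
        by (simp add: P_Suc D_def grad_mult inner_add_left)
    qed
    have M_first: "M (Suc 0) s t =
        (if t = 1 then f 1 x else if t = 2 then generator b \<sigma> (f 1) x else D (f 1) (t - 2))" for s t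
      by (simp add: M_def generator_core_def first_core_def f_def D_def delta_def jacobian_row_def)
    have M_last: "M p s t =
        (if s = 1 then generator b \<sigma> (f p) x else if s = 2 then f p x else D (f p) (s - 2))" for s t
      using assms(1)
      by (simp add: M_def generator_core_def last_core_def f_def D_def delta_def jacobian_row_def)
    have M_middle: "M k s t =
        (if s = 1 then (if t = 1 then f k x else if t = 2 then generator b \<sigma> (f k) x else D (f k) (t - 2))
         else if s = 2 then (if t = 2 then f k x else 0)
         else (if t = 2 then D (f k) (s - 2) else if t = s then f k x else 0))"
      if "1 < k" "k < p" for k s t
      using that
      by (simp add: M_def generator_core_def middle_core_def f_def D_def delta_def jacobian_row_def)
    have v_Suc: "v (Suc m) t = (\<Sum>s=1..r m. v m s * M (Suc m) s t)"
      if "m < p" "t \<in> {1..r (Suc m)}" for m t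
    proof (cases "m = 0")
      \<comment> \<open>As \<open>r 0 = 1\<close> and \<open>p \<ge> 2\<close>, the first core is
        itself the row of \<open>P 1\<close>.\<close>
      case True
      then show ?thesis
        using assms(1) by (simp add: v_def r_def M_first P_1)
    next
      case False
      have r_m: "r m = d + 2"
        using False that(1) by (simp add: r_def)
      have expand: "(\<Sum>s=1..r m. v m s * M (Suc m) s t) = P m x * M (Suc m) 1 t +
          generator b \<sigma> (P m) x * M (Suc m) 2 t + (\<Sum>i=1..d. D (P m) i * M (Suc m) (i + 2) t)"
        unfolding r_m sum_split_first_two using False that(1) by (simp add: v_def)
      have "\<exists>i\<in>{1..d}. t = i + 2" if "Suc m < p" "t \<noteq> 1" "t \<noteq> 2"
        using that \<open>t \<in> {1..r (Suc m)}\<close> by (intro bexI[of _ "t - 2"]) (auto simp: r_def)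
      then consider "Suc m = p" | "Suc m < p" "t = 1" | "Suc m < p" "t = 2"
        | i where "Suc m < p" "t = i + 2" "i \<in> {1..d}"
        using Suc_lessI[OF \<open>m < p\<close>] by metis
      then show ?thesis
      proof cases
        \<comment> \<open>The last core pairs \<open>P m\<close> with the generator of
          \<open>f p\<close>, the generator of \<open>P m\<close> with \<open>f p\<close>, and the
          \<open>D\<close> entries with each other: the product rule.\<close>
        case 1
        then show ?thesis
          unfolding expand using L_Suc[OF that(1)] by (simp add: v_def M_last)
      next
        \<comment> \<open>The first column vanishes below its top entry.\<close>
        case 2
        then show ?thesis
          unfolding expand using False by (simp add: v_def M_middle P_Suc)
      next
        \<comment> \<open>The second column has the entries of the last core, so the product rule
          applies again.\<close>
        case 3
        then show ?thesis
          unfolding expand using False L_Suc[OF that(1)] by (simp add: v_def M_middle)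
      next
        case (4 i)
        \<comment> \<open>Below the first two rows of column \<open>t\<close>, only the diagonal
          entry survives; together with the top entry it gives \<open>D_Suc\<close>.\<close>
        have "(\<Sum>j=1..d. D (P m) j * M (Suc m) (j + 2) t) =
            (\<Sum>j=1..d. if i = j then D (P m) j * f (Suc m) x else 0)"
          using 4 False by (intro sum.cong) (auto simp: M_middle)
        then show ?thesis
          unfolding expand using 4 False D_Suc[OF that(1)] by (simp add: v_def M_middle)
      qed
    qed
    \<comment> \<open>With constant weight 1 the chain sum is the represented tensor entry.\<close>
    have "tt_tensor p r (generator_core e p b \<sigma> \<psi> x) u = (\<Sum>t=1..r p. v p t)"
      using sum_PiE_matrix_chain[of r v p M p "\<lambda>_. 1"] v_Suc
      by (simp add: tt_tensor_def tensor_product_def M_def v_def)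
    also have "\<dots> = generator b \<sigma> (P p) x"
      using assms(1) by (simp add: r_def v_def)
    finally show ?thesis
      by (simp add: generator_tensor_def P_def f_def)
  qed
  then show ?thesis
    unfolding tt_representation_def d_def[symmetric] r_def[symmetric] by (simp add: r_def)
qed

end
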